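(* Let $R$ be a finite commutative ring with multiplicative identity, different from the zero ring, and let $A\subseteq R$. Let $2\le k<n$. (1) For arbitrary functions $f_i:R^{2i-2}\to R$, $2\le i\le n$, the spectrum of $B\Gamma(R;f_2,\ldots,f_k)[A]$ is contained, as a multiset, in the spectrum of $B\Gamma(R;f_2,\ldots,f_n)[A]$. (2) For symmetric functions $f_i:R^{2i-2}\to R$, $2\le i\le n$, the spectrum of $\Gamma(R;f_2,\ldots,f_k)[A]$ is contained, as a multiset, in the spectrum of $\Gamma(R;f_2,\ldots,f_n)[A]$, provided no edge of $\Gamma(R;f_2,\ldots,f_n)[A]$ projects to a loop of $\Gamma(R;f_2,\ldots,f_k)[A]$, i.e. provided there is no edge $uv$ of $\Gamma(R;f_2,\ldots,f_n)[A]$ for which $u$ and $v$ have the same first $k$ coordinates.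
   Context: The spectrum of a graph is the multiset of eigenvalues of its adjacency matrix. For $m\ge 2$ and functions $f_i:R^{2i-2}\to R$, the bipartite graph $B\Gamma(R;f_2,\ldots,f_m)$ has vertex set the disjoint union of two copies of $R^m$: points $(p)=(p_1,\ldots,p_m)$ and lines $[l]=[l_1,\ldots,l_m]$; $(p)$ and $[l]$ are adjacent iff $p_i+l_i=f_i(p_1,l_1,\ldots,p_{i-1},l_{i-1})$ for all $2\le i\le m$. $B\Gamma(R;f_2,\ldots,f_m)[A]$ is its subgraph induced on the points with $p_1\in A$ and the lines with $l_1\in A$. A function $f_i$ is symmetric if $f_i(x_1,y_1,\ldots,x_{i-1},y_{i-1})=f_i(y_1,x_1,\ldots,y_{i-1},x_{i-1})$. For symmetric $f_i$, $\Gamma(R;f_2,\ldots,f_m)$ is the graph on vertex set $R^m$ in which distinct vertices $a,b$ are adjacent iff $a_i+b_i=f_i(a_1,b_1,\ldots,a_{i-1},b_{i-1})$ for all $2\le i\le m$; a vertex $a$ of $\Gamma(R;f_2,\ldots,f_m)$ is said to have a loop if it satisfies these relations with $b=a$. $\Gamma(R;f_2,\ldots,f_m)[A]$ is the subgraph induced on vertices with first coordinate in $A$. *)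

theory Defs
  imports "Graph_Theory.Digraph_Component" "Jordan_Normal_Form.Char_Poly" Complex_Main
begin

definition adjacency_matrix :: "('a, 'b) pre_digraph \<Rightarrow> 'a list \<Rightarrow> complex mat" where
  "adjacency_matrix G vs =
     mat (length vs) (length vs) (\<lambda>(i, j). of_bool (vs ! i \<rightarrow>\<^bsub>G\<^esub> vs ! j))"

text \<open>
  The multiset of eigenvalues with algebraic multiplicities, i.e. the roots of the characteristic
  polynomial. The enumeration of the vertices is immaterial: see \<open>graph_spectrum_eq\<close>.
\<close>

definition graph_spectrum :: "('a, 'b) pre_digraph \<Rightarrow> complex multiset" where
  "graph_spectrum G =
     proots (char_poly (adjacency_matrix G (SOME vs. distinct vs \<and> set vs = verts G)))"

text \<open>
  An element of \<open>R\<^sup>m\<close> is a list of length \<open>m\<close>, so that the coordinate \<open>p\<^sub>i\<close> is \<open>p ! (i - 1)\<close>.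
  The functions \<open>f\<^sub>2, \<dots>, f\<^sub>m\<close> form a family indexed by \<open>nat\<close> of functions on lists;
  \<open>f i\<close> is only ever applied to the lists \<open>[x\<^sub>1, y\<^sub>1, \<dots>, x\<^bsub>i-1\<^esub>, y\<^bsub>i-1\<^esub>]\<close> of length \<open>2i - 2\<close>,
  which is what \<open>splice\<close> yields on two lists of length \<open>i - 1\<close>.
\<close>

definition tuples :: "nat \<Rightarrow> 'r list set" where
  "tuples m = {p. length p = m}"

definition defining_relations ::
    "(nat \<Rightarrow> 'r list \<Rightarrow> 'r) \<Rightarrow> nat \<Rightarrow> 'r::comm_ring_1 list \<Rightarrow> 'r list \<Rightarrow> bool" where
  "defining_relations f m p l \<longleftrightarrow>
     (\<forall>i\<in>{2..m}. p ! (i - 1) + l ! (i - 1) = f i (splice (take (i - 1) p) (take (i - 1) l)))"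

definition symmetric_function :: "nat \<Rightarrow> ('r list \<Rightarrow> 'r) \<Rightarrow> bool" where
  "symmetric_function i g \<longleftrightarrow>
     (\<forall>xs\<in>tuples (i - 1). \<forall>ys\<in>tuples (i - 1). g (splice xs ys) = g (splice ys xs))"

text \<open>Points are tagged \<open>Inl\<close>, lines \<open>Inr\<close>; each undirected edge is a pair of opposite arcs.\<close>

definition BGamma :: "(nat \<Rightarrow> 'r list \<Rightarrow> 'r) \<Rightarrow> nat \<Rightarrow>
    ('r::comm_ring_1 list + 'r list, ('r list + 'r list) \<times> ('r list + 'r list)) pre_digraph" where
  "BGamma f m =
     \<lparr> verts = tuples m <+> tuples m,
       arcs = {(Inl p, Inr l) | p l. p \<in> tuples m \<and> l \<in> tuples m \<and> defining_relations f m p l}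
            \<union> {(Inr l, Inl p) | p l. p \<in> tuples m \<and> l \<in> tuples m \<and> defining_relations f m p l},
       tail = fst, head = snd \<rparr>"

definition BGamma_on :: "(nat \<Rightarrow> 'r list \<Rightarrow> 'r) \<Rightarrow> nat \<Rightarrow> 'r set \<Rightarrow>
    ('r::comm_ring_1 list + 'r list, ('r list + 'r list) \<times> ('r list + 'r list)) pre_digraph" where
  "BGamma_on f m A =
     BGamma f m \<restriction> ({p \<in> tuples m. p ! 0 \<in> A} <+> {l \<in> tuples m. l ! 0 \<in> A})"

definition Gamma :: "(nat \<Rightarrow> 'r list \<Rightarrow> 'r) \<Rightarrow> nat \<Rightarrow>
    ('r::comm_ring_1 list, 'r list \<times> 'r list) pre_digraph" where
  "Gamma f m =
     \<lparr> verts = tuples m,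
       arcs = {(a, b). a \<in> tuples m \<and> b \<in> tuples m \<and> a \<noteq> b \<and> defining_relations f m a b},
       tail = fst, head = snd \<rparr>"

definition Gamma_on :: "(nat \<Rightarrow> 'r list \<Rightarrow> 'r) \<Rightarrow> nat \<Rightarrow> 'r set \<Rightarrow>
    ('r::comm_ring_1 list, 'r list \<times> 'r list) pre_digraph" where
  "Gamma_on f m A = Gamma f m \<restriction> {a \<in> tuples m. a ! 0 \<in> A}"

lemma finite_tuples [simp]: "finite (tuples m :: 'r::finite list set)"
  using finite_lists_length_eq[of "UNIV :: 'r set" m] by (simp add: tuples_def)

lemma graph_BGamma_on:
  fixes f :: "nat \<Rightarrow> 'r::{finite,comm_ring_1} list \<Rightarrow> 'r"
  shows "graph (BGamma_on f m A)"
proof -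
  let ?G = "BGamma_on f m A"
  have fin: "finite (verts ?G)"
    by (simp add: BGamma_on_def)
  have sub: "arcs ?G \<subseteq> verts ?G \<times> verts ?G"
    by (auto simp: BGamma_on_def BGamma_def)
  show ?thesis
  proof
    show "finite (arcs ?G)"
      using fin sub by (meson finite_SigmaI finite_subset)
  qed (use fin in \<open>auto simp: BGamma_on_def BGamma_def symmetric_conv arc_to_ends_def\<close>)
qed

lemma defining_relations_sym:
  assumes "\<And>i. i \<in> {2..m} \<Longrightarrow> symmetric_function i (f i)" "a \<in> tuples m" "b \<in> tuples m"
  shows "defining_relations f m a b \<longleftrightarrow> defining_relations f m b a"
proof -
  have "f i (splice (take (i - 1) a) (take (i - 1) b)) = f i (splice (take (i - 1) b) (take (i - 1) a))"
    if "i \<in> {2..m}" for i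
  proof -
    have "take (i - 1) a \<in> tuples (i - 1)" "take (i - 1) b \<in> tuples (i - 1)"
      using that assms(2,3) by (auto simp: tuples_def)
    then show ?thesis
      using assms(1)[OF that] unfolding symmetric_function_def by blast
  qed
  then show ?thesis
    unfolding defining_relations_def by (metis add.commute)
qed

lemma graph_Gamma_on:
  fixes f :: "nat \<Rightarrow> 'r::{finite,comm_ring_1} list \<Rightarrow> 'r"
  assumes "\<And>i. i \<in> {2..m} \<Longrightarrow> symmetric_function i (f i)"
  shows "graph (Gamma_on f m A)"
proof -
  let ?G = "Gamma_on f m A"
  have fin: "finite (verts ?G)"
    by (simp add: Gamma_on_def)
  have sub: "arcs ?G \<subseteq> verts ?G \<times> verts ?G"
    by (auto simp: Gamma_on_def Gamma_def)
  show ?thesis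
  proof
    show "finite (arcs ?G)"
      using fin sub by (meson finite_SigmaI finite_subset)
    show "symmetric ?G"
      using defining_relations_sym[of m f, OF assms]
      by (auto simp: Gamma_on_def Gamma_def symmetric_conv)
  qed (use fin in \<open>auto simp: Gamma_on_def Gamma_def arc_to_ends_def\<close>)
qed

lemma sum_of_bool_nth_eq:
  fixes g :: "nat \<Rightarrow> 'c::comm_ring_1"
  assumes "distinct ws" "j < length ws" "x = ws ! j"
  shows "(\<Sum>k = 0..<length ws. of_bool (x = ws ! k) * g k) = g j"
proof -
  have "(\<Sum>k = 0..<length ws. of_bool (x = ws ! k) * g k)
      = (\<Sum>k = 0..<length ws. if k = j then g k else 0)"
    using assms by (intro sum.cong) (auto simp: nth_eq_iff_index_eq)
  then show ?thesis
    using assms(2) by simp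
qed

lemma char_poly_adjacency_matrix_eq:
  assumes vs: "distinct vs" and ws: "distinct ws" and eq: "set vs = set ws"
  shows "char_poly (adjacency_matrix G vs) = char_poly (adjacency_matrix G ws)"
proof -
  define n where "n = length vs"
  have n: "length vs = n" "length ws = n"
    using vs ws eq by (auto simp: n_def) (metis distinct_card)
  let ?A = "adjacency_matrix G vs" and ?B = "adjacency_matrix G ws"
  define P :: "complex mat" where "P = mat n n (\<lambda>(i, j). of_bool (vs ! i = ws ! j))"
  define Q :: "complex mat" where "Q = mat n n (\<lambda>(i, j). of_bool (ws ! i = vs ! j))"
  have car: "?A \<in> carrier_mat n n" "?B \<in> carrier_mat n n" "P \<in> carrier_mat n n" "Q \<in> carrier_mat n n"
    by (auto simp: adjacency_matrix_def n P_def Q_def)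
  have ix: "\<exists>j<n. vs ! i = ws ! j" if "i < n" for i
    using that eq n by (metis in_set_conv_nth)
  have ix': "\<exists>j<n. ws ! i = vs ! j" if "i < n" for i
    using that eq n by (metis in_set_conv_nth)
  have PM: "(P * M) $$ (i, j) = M $$ (k, j)"
    if "M \<in> carrier_mat n n" "i < n" "j < n" "k < n" "vs ! i = ws ! k" for M i j k
  proof -
    have "(P * M) $$ (i, j) = (\<Sum>m = 0..<n. of_bool (vs ! i = ws ! m) * M $$ (m, j))"
      using that by (auto simp: scalar_prod_def P_def intro!: sum.cong)
    then show ?thesis
      using sum_of_bool_nth_eq[OF ws, of k "vs ! i" "\<lambda>m. M $$ (m, j)"] that n by simp
  qed
  have QM: "(Q * M) $$ (i, j) = M $$ (k, j)"
    if "M \<in> carrier_mat n n" "i < n" "j < n" "k < n" "ws ! i = vs ! k" for M i j k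
  proof -
    have "(Q * M) $$ (i, j) = (\<Sum>m = 0..<n. of_bool (ws ! i = vs ! m) * M $$ (m, j))"
      using that by (auto simp: scalar_prod_def Q_def intro!: sum.cong)
    then show ?thesis
      using sum_of_bool_nth_eq[OF vs, of k "ws ! i" "\<lambda>m. M $$ (m, j)"] that n by simp
  qed
  have PQ: "P * Q = 1\<^sub>m n"
  proof (rule eq_matI)
    fix i j assume ij: "i < dim_row (1\<^sub>m n :: complex mat)" "j < dim_col (1\<^sub>m n :: complex mat)"
    then obtain k where k: "k < n" "vs ! i = ws ! k" using ix by auto
    have "(P * Q) $$ (i, j) = Q $$ (k, j)"
      using ij k car by (intro PM) auto
    also have "\<dots> = of_bool (vs ! i = vs ! j)"
      using ij k by (simp add: Q_def)
    finally show "(P * Q) $$ (i, j) = 1\<^sub>m n $$ (i, j)"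
      using ij vs n by (simp add: nth_eq_iff_index_eq)
  qed (auto simp: P_def Q_def)
  have QP: "Q * P = 1\<^sub>m n"
  proof (rule eq_matI)
    fix i j assume ij: "i < dim_row (1\<^sub>m n :: complex mat)" "j < dim_col (1\<^sub>m n :: complex mat)"
    then obtain k where k: "k < n" "ws ! i = vs ! k" using ix' by auto
    have "(Q * P) $$ (i, j) = P $$ (k, j)"
      using ij k car by (intro QM) auto
    also have "\<dots> = of_bool (ws ! i = ws ! j)"
      using ij k by (simp add: P_def)
    finally show "(Q * P) $$ (i, j) = 1\<^sub>m n $$ (i, j)"
      using ij ws n by (simp add: nth_eq_iff_index_eq)
  qed (auto simp: P_def Q_def)
  have AP: "?A * P = P * ?B"
  proof (rule eq_matI)
    fix i j assume "i < dim_row (P * ?B)" "j < dim_col (P * ?B)"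
    then have ij: "i < n" "j < n" using car by auto
    obtain k where k: "k < n" "vs ! i = ws ! k" using ix ij by auto
    obtain l where l: "l < n" "ws ! j = vs ! l" using ix' ij by auto
    have "(?A * P) $$ (i, j) = (\<Sum>m = 0..<n. of_bool (ws ! j = vs ! m) * ?A $$ (i, m))"
      using ij car by (auto simp: scalar_prod_def P_def intro!: sum.cong)
    also have "\<dots> = ?A $$ (i, l)"
      using sum_of_bool_nth_eq[OF vs, of l "ws ! j" "\<lambda>m. ?A $$ (i, m)"] l n by simp
    also have "\<dots> = ?B $$ (k, j)"
      using ij k l n by (simp add: adjacency_matrix_def)
    also have "\<dots> = (P * ?B) $$ (i, j)"
      using PM[OF car(2) ij k] by simp
    finally show "(?A * P) $$ (i, j) = (P * ?B) $$ (i, j)" .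
  qed (use car in auto)
  have "?A = ?A * (P * Q)"
    using car by (simp add: PQ)
  also have "\<dots> = P * ?B * Q"
    using assoc_mult_mat[OF car(1,3,4)] by (simp add: AP)
  finally have "similar_mat_wit ?A ?B P Q"
    using car PQ QP by (auto simp: similar_mat_wit_def Let_def)
  then show ?thesis
    by (intro char_poly_similar) (auto simp: similar_mat_def)
qed

lemma graph_spectrum_eq:
  assumes "distinct vs" "set vs = verts G"
  shows "graph_spectrum G = proots (char_poly (adjacency_matrix G vs))"
proof -
  have "distinct (SOME vs. distinct vs \<and> set vs = verts G) \<and>
        set (SOME vs. distinct vs \<and> set vs = verts G) = verts G"
    using assms by (intro someI[where P = "\<lambda>vs. distinct vs \<and> set vs = verts G"]) auto
  then show ?thesis
    unfolding graph_spectrum_def using assms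
    by (intro arg_cong[where f = proots] char_poly_adjacency_matrix_eq) auto
qed

end

theory Submission
  imports Defs
begin

text \<open>
  Truncating tuples to the first \<open>k\<close> coordinates is a covering map: once a vertex \<open>u\<close> and the first
  \<open>k\<close> coordinates of a neighbour are fixed, the remaining relations determine the remaining
  coordinates of the neighbour one at a time. (For \<open>\<Gamma>\<close>, the hypothesis on loops makes
  the projection of an edge an edge.) If \<open>G\<close> covers \<open>H\<close> and \<open>S\<close> is the incidence matrix of the
  fibres, then \<open>M S = S B\<close> for the adjacency matrices \<open>M\<close> of \<open>G\<close> and \<open>B\<close> of \<open>H\<close>. Listing a
  section of the covering first gives \<open>S\<close> the shape \<open>(I, T)\<^sup>T\<close>, and conjugating \<open>M\<close> by the
  unitriangular matrix with lower left block \<open>T\<close> makes it block triangular with \<open>B\<close> as a diagonal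
  block, so the characteristic polynomial of \<open>B\<close> divides that of \<open>M\<close>.
\<close>

section \<open>Block matrices and divisibility of characteristic polynomials\<close>

lemma char_poly_four_block_mat_lower_left_zero:
  fixes A :: "'a::field mat"
  assumes A: "A \<in> carrier_mat n n" and B: "B \<in> carrier_mat n m" and D: "D \<in> carrier_mat m m"
  shows "char_poly (four_block_mat A B (0\<^sub>m m n) D) = char_poly A * char_poly D"
proof -
  have "char_poly_matrix (four_block_mat A B (0\<^sub>m m n) D) =
      four_block_mat (char_poly_matrix A) (map_mat (\<lambda>a. [:- a:]) B) (0\<^sub>m m n) (char_poly_matrix D)"
    by (rule eq_matI) (use A B D in \<open>auto simp: char_poly_matrix_def one_mat_def\<close>)
  then show ?thesis
    unfolding char_poly_def
    by (simp, intro det_four_block_mat_lower_left_zero) (use A B D in auto)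
qed

text \<open>Together \<open>top\<close> and \<open>bot\<close> say that the columns of
  \<open>(I, T)\<close>, stacked vertically, span a subspace invariant under the block matrix, which
  acts on it as \<open>E\<close>. The base change \<open>P\<close> has these columns as its first
  \<open>n\<close> columns.\<close>

lemma char_poly_dvd_four_block_mat:
  fixes A :: "'a::field mat"
  assumes A: "A \<in> carrier_mat n n" and B: "B \<in> carrier_mat n m"
    and C: "C \<in> carrier_mat m n" and D: "D \<in> carrier_mat m m"
    and T: "T \<in> carrier_mat m n" and E: "E \<in> carrier_mat n n"
    and top: "A + B * T = E" and bot: "C + D * T = T * E"
  shows "char_poly E dvd char_poly (four_block_mat A B C D)"
proof -
  \<comment> \<open>\<open>F\<close> is the lower right block of \<open>Q * ?M * P\<close>, the
    action on the quotient by the invariant subspace.\<close>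
  define F where "F = D - T * B"
  define P where "P = four_block_mat (1\<^sub>m n) (0\<^sub>m n m) T (1\<^sub>m m)"
  define Q where "Q = four_block_mat (1\<^sub>m n) (0\<^sub>m n m) (- T) (1\<^sub>m m)"
  define U where "U = four_block_mat E B (0\<^sub>m m n) F"
  let ?M = "four_block_mat A B C D"
  have F: "F \<in> carrier_mat m m"
    unfolding F_def using B T by (intro minus_carrier_mat mult_carrier_mat)
  have car: "?M \<in> carrier_mat (n + m) (n + m)" "P \<in> carrier_mat (n + m) (n + m)"
    "Q \<in> carrier_mat (n + m) (n + m)" "U \<in> carrier_mat (n + m) (n + m)"
    using A B C D T E F by (auto simp: P_def Q_def U_def)
  have "T + - T = 0\<^sub>m m n" "- 0\<^sub>m n n = (0\<^sub>m n n :: 'a mat)"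
    using T by (auto intro!: eq_matI)
  then have PQ: "P * Q = 1\<^sub>m (n + m)"
    unfolding P_def Q_def
    by (subst mult_four_block_mat[where ?n1.0 = n and ?n2.0 = m]) (use T in auto)
  have QP: "Q * P = 1\<^sub>m (n + m)"
    unfolding P_def Q_def
    by (subst mult_four_block_mat[where ?n1.0 = n and ?n2.0 = m]) (use T in auto)
  have "T * B + F = D"
    by (rule eq_matI) (use B D T in \<open>auto simp: F_def\<close>)
  then have PU: "P * U = four_block_mat E B (T * E) D"
    unfolding P_def U_def
    by (subst mult_four_block_mat[where ?n1.0 = n and ?n2.0 = m]) (use T E B F in auto)
  have MP: "?M * P = four_block_mat E B (T * E) D"
    unfolding P_def
    by (subst mult_four_block_mat[where ?n1.0 = n and ?n2.0 = m]) (use A B C D T top bot in auto)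
  have "?M = ?M * (P * Q)"
    unfolding PQ using car(1) by (rule right_mult_one_mat[symmetric])
  also have "\<dots> = P * U * Q"
    using assoc_mult_mat[OF car(1,2,3)] by (simp add: MP PU)
  finally have "similar_mat_wit ?M U P Q"
    using car PQ QP by (auto simp: similar_mat_wit_def Let_def)
  then have "char_poly ?M = char_poly U"
    by (intro char_poly_similar) (auto simp: similar_mat_def)
  also have "\<dots> = char_poly E * char_poly F"
    unfolding U_def by (rule char_poly_four_block_mat_lower_left_zero[OF E B F])
  finally show ?thesis
    by simp
qed

section \<open>Spectra under coverings of digraphs\<close>

text \<open>By \<open>lift\<close> and \<open>hom\<close>, \<phi> maps the out-neighbours of each
  \<open>u\<close> bijectively onto those of its image. So counting the out-neighbours of
  \<open>u\<close> in each fibre reproduces a row of the adjacency matrix of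
  \<open>H\<close>.\<close>

lemma graph_spectrum_subseteq_covering:
  fixes G :: "('a, 'b) pre_digraph" and H :: "('c, 'd) pre_digraph"
  assumes fin: "finite (verts G)" and surj: "\<phi> ` verts G = verts H"
    and lift: "\<And>u y. u \<in> verts G \<Longrightarrow> y \<in> verts H \<Longrightarrow> \<phi> u \<rightarrow>\<^bsub>H\<^esub> y \<Longrightarrow>
                 \<exists>!v. v \<in> verts G \<and> \<phi> v = y \<and> u \<rightarrow>\<^bsub>G\<^esub> v"
    and hom: "\<And>u v. u \<in> verts G \<Longrightarrow> v \<in> verts G \<Longrightarrow> u \<rightarrow>\<^bsub>G\<^esub> v \<Longrightarrow> \<phi> u \<rightarrow>\<^bsub>H\<^esub> \<phi> v"
  shows "graph_spectrum H \<subseteq># graph_spectrum G"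
proof -
  define s where "s = inv_into (verts G) \<phi>"
  have s: "s y \<in> verts G" "\<phi> (s y) = y" if "y \<in> verts H" for y
    using that unfolding s_def surj[symmetric] by (auto intro: inv_into_into f_inv_into_f)
  have finH: "finite (verts H)"
    using fin surj by (metis finite_imageI)
  obtain ys where ys: "distinct ys" "set ys = verts H"
    using finite_distinct_list[OF finH] by auto
  obtain rs where rs: "distinct rs" "set rs = verts G - s ` verts H"
    using finite_distinct_list[of "verts G - s ` verts H"] fin by auto
  have inj: "inj_on s (verts H)"
    using s(2) by (metis inj_onI)
  \<comment> \<open>One representative per fibre comes first, in the order of \<open>ys\<close>, so
    the upper block of the fibre incidence matrix is the identity and its lower block is
    \<open>?T\<close>.\<close>
  define vs where "vs = map s ys @ rs"
  have vs: "distinct vs" "set vs = verts G"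
    using ys rs inj s(1) by (auto simp: vs_def distinct_map)
  define n where "n = length ys"
  define m where "m = length rs"
  define g :: "'a \<Rightarrow> 'a \<Rightarrow> complex" where "g u v = of_bool (u \<rightarrow>\<^bsub>G\<^esub> v)" for u v
  define h :: "'c \<Rightarrow> 'c \<Rightarrow> complex" where "h x y = of_bool (x \<rightarrow>\<^bsub>H\<^esub> y)" for x y
  let ?A = "mat n n (\<lambda>(i, j). g (s (ys ! i)) (s (ys ! j)))"
  let ?B = "mat n m (\<lambda>(i, j). g (s (ys ! i)) (rs ! j))"
  let ?C = "mat m n (\<lambda>(i, j). g (rs ! i) (s (ys ! j)))"
  let ?D = "mat m m (\<lambda>(i, j). g (rs ! i) (rs ! j))"
  let ?T = "mat m n (\<lambda>(i, j). of_bool (\<phi> (rs ! i) = ys ! j) :: complex)"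
  let ?E = "adjacency_matrix H ys"
  have E: "?E $$ (i, j) = h (ys ! i) (ys ! j)" if "i < n" "j < n" for i j
    using that by (auto simp: adjacency_matrix_def n_def h_def)
  have carE: "?E \<in> carrier_mat n n"
    by (auto simp: adjacency_matrix_def n_def)
  have block: "adjacency_matrix G vs = four_block_mat ?A ?B ?C ?D"
    by (rule eq_matI) (auto simp: adjacency_matrix_def vs_def n_def m_def g_def nth_append)
  \<comment> \<open>The left side counts the out-neighbours of \<open>u\<close> in the fibre over
    \<open>y\<close>: first the representative \<open>s y\<close>, then the other members of the
    fibre. By unique lifting the count is 1 or 0.\<close>
  have fibre: "g u (s y) + (\<Sum>l<m. g u (rs ! l) * of_bool (\<phi> (rs ! l) = y)) = h (\<phi> u) y"
    if u: "u \<in> verts G" and y: "y \<in> verts H" for u y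
  proof -
    let ?k = "\<lambda>v. g u v * of_bool (\<phi> v = y)"
    have "(\<Sum>v\<in>s ` verts H. ?k v) = (\<Sum>x\<in>verts H. if x = y then g u (s x) else 0)"
      unfolding sum.reindex[OF inj] by (intro sum.cong) (auto simp: s(2))
    then have 1: "(\<Sum>v\<in>s ` verts H. ?k v) = g u (s y)"
      using y finH by simp
    have 2: "(\<Sum>l<m. ?k (rs ! l)) = (\<Sum>v\<in>set rs. ?k v)"
      unfolding m_def using rs(1)
      by (intro sum.reindex_bij_betw bij_betw_nth) auto
    have "g u (s y) + (\<Sum>l<m. ?k (rs ! l)) = (\<Sum>v\<in>verts G. ?k v)"
      unfolding 1[symmetric] 2 rs(2) using fin s(1)
      by (subst add.commute, intro sum.subset_diff[symmetric]) auto
    also have "\<dots> = h (\<phi> u) y"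
    proof (cases "\<phi> u \<rightarrow>\<^bsub>H\<^esub> y")
      case True
      obtain w where w: "w \<in> verts G" "\<phi> w = y" "u \<rightarrow>\<^bsub>G\<^esub> w"
        and uniq: "\<And>v. v \<in> verts G \<Longrightarrow> \<phi> v = y \<Longrightarrow> u \<rightarrow>\<^bsub>G\<^esub> v \<Longrightarrow> v = w"
        using lift[OF u y True] unfolding Ex1_def by blast
      have "?k v = of_bool (v = w)" if "v \<in> verts G" for v
      proof -
        have "u \<rightarrow>\<^bsub>G\<^esub> v \<and> \<phi> v = y \<longleftrightarrow> v = w"
          using w uniq that by blast
        then show ?thesis
          unfolding g_def of_bool_conj[symmetric] by (rule arg_cong)
      qed
      then have "(\<Sum>v\<in>verts G. ?k v) = (\<Sum>v\<in>verts G. if v = w then 1 else 0)"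
        by (intro sum.cong) (auto simp del: sum_mult_of_bool_eq)
      then show ?thesis
        using w fin True by (simp add: h_def)
    next
      case False
      have "(\<Sum>v\<in>verts G. ?k v) = 0"
        using hom[OF u] False by (intro sum.neutral) (auto simp: g_def)
      then show ?thesis
        using False by (simp add: h_def)
    qed
    finally show ?thesis .
  qed
  \<comment> \<open>This is \<open>fibre\<close> for the representatives \<open>s (ys ! i)\<close>,
    which lie over \<open>ys ! i\<close>.\<close>
  have top: "?A + ?B * ?T = ?E"
  proof (rule eq_matI)
    fix i j assume "i < dim_row ?E" "j < dim_col ?E"
    then have ij: "i < n" "j < n" using carE by auto
    then have y: "ys ! i \<in> verts H" "ys ! j \<in> verts H"
      unfolding ys(2)[symmetric] n_def by simp_all
    have "(?A + ?B * ?T) $$ (i, j) = g (s (ys ! i)) (s (ys ! j)) +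
        (\<Sum>l<m. g (s (ys ! i)) (rs ! l) * of_bool (\<phi> (rs ! l) = ys ! j))"
      using ij by (simp add: scalar_prod_def atLeast0LessThan)
    also have "\<dots> = ?E $$ (i, j)"
      unfolding fibre[OF s(1)[OF y(1)] y(2)] s(2)[OF y(1)] E[OF ij] ..
    finally show "(?A + ?B * ?T) $$ (i, j) = ?E $$ (i, j)" .
  qed (use carE in auto)
  have bot: "?C + ?D * ?T = ?T * ?E"
  proof (rule eq_matI)
    fix i j assume "i < dim_row (?T * ?E)" "j < dim_col (?T * ?E)"
    then have ij: "i < m" "j < n" using carE by auto
    have "rs ! i \<in> set rs" "ys ! j \<in> set ys"
      using ij by (simp_all add: n_def m_def)
    then have u: "rs ! i \<in> verts G" "ys ! j \<in> verts H"
      unfolding ys(2) rs(2) by auto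
    then have "\<phi> (rs ! i) \<in> set ys"
      using surj ys(2) by auto
    then obtain l where l: "l < length ys" "\<phi> (rs ! i) = ys ! l"
      by (metis in_set_conv_nth)
    \<comment> \<open>Row \<open>i\<close> of \<open>?T\<close> has a single 1, in the column of the
      image of \<open>rs ! i\<close>, so the product picks out that row of
      \<open>?E\<close>.\<close>
    have "(?T * ?E) $$ (i, j) = (\<Sum>k = 0..<n. of_bool (\<phi> (rs ! i) = ys ! k) * h (ys ! k) (ys ! j))"
      using ij carE by (auto simp: scalar_prod_def E intro!: sum.cong)
    also have "\<dots> = h (\<phi> (rs ! i)) (ys ! j)"
      using sum_of_bool_nth_eq[OF ys(1) l, of "\<lambda>k. h (ys ! k) (ys ! j)"] l by (simp add: n_def)
    also have "\<dots> = g (rs ! i) (s (ys ! j)) +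
        (\<Sum>l<m. g (rs ! i) (rs ! l) * of_bool (\<phi> (rs ! l) = ys ! j))"
      by (rule fibre[OF u, symmetric])
    also have "\<dots> = (?C + ?D * ?T) $$ (i, j)"
      using ij by (simp add: scalar_prod_def atLeast0LessThan)
    finally show "(?C + ?D * ?T) $$ (i, j) = (?T * ?E) $$ (i, j)" ..
  qed (use carE in auto)
  have "char_poly ?E dvd char_poly (adjacency_matrix G vs)"
    unfolding block by (rule char_poly_dvd_four_block_mat[OF _ _ _ _ _ carE top bot]) auto
  then obtain q where q: "char_poly (adjacency_matrix G vs) = char_poly ?E * q"
    by (rule dvdE)
  have "adjacency_matrix G vs \<in> carrier_mat (length vs) (length vs)"
    by (simp add: adjacency_matrix_def)
  \<comment> \<open>Being monic, the polynomial is nonzero; hence so are both factors, and the root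
    multiset of the product is the sum of theirs.\<close>
  from degree_monic_char_poly[OF this] have "char_poly (adjacency_matrix G vs) \<noteq> 0"
    by auto
  then have "proots (char_poly (adjacency_matrix G vs)) = proots (char_poly ?E) + proots q"
    unfolding q by (intro proots_mult) auto
  then show ?thesis
    by (simp add: graph_spectrum_eq[OF vs] graph_spectrum_eq[OF ys])
qed

section \<open>Unique lifting of the defining relations\<close>

text \<open>Each new coordinate is a function of the earlier ones. In the induction, the first
  \<open>m\<close> coordinates of a solution are the unique shorter solution \<open>l\<close>, and
  the last one is forced to be \<open>F m l\<close>.\<close>

lemma triangular_system_unique_solution:
  assumes "k \<le> n" "y \<in> tuples k"
  shows "\<exists>!l. l \<in> tuples n \<and> take k l = y \<and> (\<forall>i\<in>{k..<n}. l ! i = F i (take i l))"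
  using assms(1)
proof (induction n rule: dec_induct)
  case base
  then show ?case
    using assms(2) by (auto simp: tuples_def)
next
  case (step m)
  then obtain l where l: "l \<in> tuples m" "take k l = y" "\<forall>i\<in>{k..<m}. l ! i = F i (take i l)"
    and uniq: "\<And>l'. l' \<in> tuples m \<Longrightarrow> take k l' = y \<Longrightarrow> \<forall>i\<in>{k..<m}. l' ! i = F i (take i l') \<Longrightarrow> l' = l"
    by metis
  show ?case
  proof (rule ex1I[of _ "l @ [F m l]"])
    show "l @ [F m l] \<in> tuples (Suc m) \<and> take k (l @ [F m l]) = y \<and>
        (\<forall>i\<in>{k..<Suc m}. (l @ [F m l]) ! i = F i (take i (l @ [F m l])))"
      using l step.hyps by (auto simp: tuples_def nth_append less_Suc_eq)
  next
    fix l' assume l': "l' \<in> tuples (Suc m) \<and> take k l' = y \<and>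
        (\<forall>i\<in>{k..<Suc m}. l' ! i = F i (take i l'))"
    then have "take m l' = l"
      using step.hyps by (intro uniq) (auto simp: tuples_def min_def)
    moreover from this have "l' ! m = F m l"
      using l' step.hyps by auto
    moreover have "l' = take m l' @ [l' ! m]"
      using l' by (auto simp: tuples_def take_Suc_conv_app_nth[symmetric])
    ultimately show "l' = l @ [F m l]"
      by simp
  qed
qed

text \<open>Relations up to \<open>k\<close> see only the first \<open>k\<close> coordinates.
  Relation \<open>Suc i\<close> governs list position \<open>i\<close>, as positions count from 0;
  \<open>1 \<le> k\<close> keeps \<open>Suc i\<close> at least 2.\<close>

lemma defining_relations_iff_take:
  assumes "1 \<le> k" "k \<le> n"
  shows "defining_relations f n p l \<longleftrightarrow>
    defining_relations f k (take k p) (take k l) \<and>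
    (\<forall>i\<in>{k..<n}. p ! i + l ! i = f (Suc i) (splice (take i p) (take i l)))"
proof -
  have "{2..n} = {2..k} \<union> Suc ` {k..<n}"
    using assms by (auto simp: image_Suc_atLeastLessThan)
  moreover have "defining_relations f k (take k p) (take k l) = defining_relations f k p l"
    unfolding defining_relations_def by (intro ball_cong) (auto simp: min_def)
  ultimately show ?thesis
    by (simp add: defining_relations_def ball_Un del: image_Suc_atLeastLessThan)
qed

text \<open>With \<open>p\<close> fixed, solving relation \<open>Suc i\<close> for
  \<open>l ! i\<close> leaves a triangular system in \<open>l\<close>.\<close>

lemma defining_relations_unique_lift:
  assumes "1 \<le> k" "k \<le> n" "y \<in> tuples k" "defining_relations f k (take k p) y"
  shows "\<exists>!l. l \<in> tuples n \<and> take k l = y \<and> defining_relations f n p l"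
proof -
  have "l \<in> tuples n \<and> take k l = y \<and> defining_relations f n p l \<longleftrightarrow>
      l \<in> tuples n \<and> take k l = y \<and>
      (\<forall>i\<in>{k..<n}. l ! i = f (Suc i) (splice (take i p) (take i l)) - p ! i)" for l
    using assms(4) by (auto simp: defining_relations_iff_take[OF assms(1,2)] eq_diff_eq add.commute)
  then show ?thesis
    using triangular_system_unique_solution[OF assms(2,3),
        of "\<lambda>i l. f (Suc i) (splice (take i p) l) - p ! i"] by simp
qed

text \<open>The mirror image, solving for the point with the line fixed: for arbitrary
  \<open>f\<close> the relations are not symmetric in their two arguments.\<close>

lemma defining_relations_unique_lift_left:
  assumes "1 \<le> k" "k \<le> n" "y \<in> tuples k" "defining_relations f k y (take k l)"
  shows "\<exists>!p. p \<in> tuples n \<and> take k p = y \<and> defining_relations f n p l"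
proof -
  have "p \<in> tuples n \<and> take k p = y \<and> defining_relations f n p l \<longleftrightarrow>
      p \<in> tuples n \<and> take k p = y \<and>
      (\<forall>i\<in>{k..<n}. p ! i = f (Suc i) (splice (take i p) (take i l)) - l ! i)" for p
    using assms(4) by (auto simp: defining_relations_iff_take[OF assms(1,2)] eq_diff_eq)
  then show ?thesis
    using triangular_system_unique_solution[OF assms(2,3),
        of "\<lambda>i p. f (Suc i) (splice p (take i l)) - l ! i"] by simp
qed

lemma take_image_tuples:
  assumes "1 \<le> k" "k \<le> n"
  shows "take k ` {a \<in> tuples n. a ! 0 \<in> A} = {a \<in> tuples k. a ! 0 \<in> A}"
proof safe
  fix a :: "'a list" assume a: "a \<in> tuples k" "a ! 0 \<in> A"
  \<comment> \<open>Any padding serves; the first coordinate survives since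
    \<open>1 \<le> k\<close>.\<close>
  have "a = take k (a @ replicate (n - k) undefined)"
    using a by (simp add: tuples_def)
  moreover have "a @ replicate (n - k) undefined \<in> {a \<in> tuples n. a ! 0 \<in> A}"
    using a assms by (auto simp: tuples_def nth_append)
  ultimately show "a \<in> take k ` {a \<in> tuples n. a ! 0 \<in> A}"
    by blast
qed (use assms in \<open>auto simp: tuples_def\<close>)

section \<open>Truncation as a covering map of the graphs\<close>

lemma verts_BGamma_on:
  "verts (BGamma_on f m A) = {p \<in> tuples m. p ! 0 \<in> A} <+> {l \<in> tuples m. l ! 0 \<in> A}"
  by (simp add: BGamma_on_def)

lemma arcs_ends_BGamma_on:
  "u \<rightarrow>\<^bsub>BGamma_on f m A\<^esub> v \<longleftrightarrow> u \<in> verts (BGamma_on f m A) \<and> v \<in> verts (BGamma_on f m A) \<and>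
     ((\<exists>p l. u = Inl p \<and> v = Inr l \<and> defining_relations f m p l) \<or>
      (\<exists>p l. u = Inr l \<and> v = Inl p \<and> defining_relations f m p l))"
  by (auto simp: BGamma_on_def BGamma_def arcs_ends_def arc_to_ends_def image_iff)

lemma verts_Gamma_on: "verts (Gamma_on f m A) = {a \<in> tuples m. a ! 0 \<in> A}"
  by (simp add: Gamma_on_def)

lemma arcs_ends_Gamma_on:
  "u \<rightarrow>\<^bsub>Gamma_on f m A\<^esub> v \<longleftrightarrow> u \<in> verts (Gamma_on f m A) \<and> v \<in> verts (Gamma_on f m A) \<and>
     u \<noteq> v \<and> defining_relations f m u v"
  by (auto simp: Gamma_on_def Gamma_def arcs_ends_def arc_to_ends_def image_iff)

text \<open>Truncation keeps points and lines apart, so a neighbour of a point lifts to a line and a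
  neighbour of a line to a point, each by its own lifting lemma.\<close>

lemma graph_spectrum_BGamma_on_subseteq:
  fixes A :: "'r::{finite,comm_ring_1} set"
  assumes k: "1 \<le> k" "k \<le> n"
  shows "graph_spectrum (BGamma_on f k A) \<subseteq># graph_spectrum (BGamma_on f n A)"
proof (rule graph_spectrum_subseteq_covering[where \<phi> = "map_sum (take k) (take k)"])
  show "finite (verts (BGamma_on f n A))"
    by (simp add: verts_BGamma_on)
  show "map_sum (take k) (take k) ` verts (BGamma_on f n A) = verts (BGamma_on f k A)"
    unfolding verts_BGamma_on take_image_tuples[OF k, symmetric]
    by (simp add: Plus_def image_Un image_image)
next
  fix u v assume "u \<rightarrow>\<^bsub>BGamma_on f n A\<^esub> v"
  then show "map_sum (take k) (take k) u \<rightarrow>\<^bsub>BGamma_on f k A\<^esub> map_sum (take k) (take k) v"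
    using k by (auto simp: arcs_ends_BGamma_on verts_BGamma_on tuples_def
        defining_relations_iff_take[OF k, of f])
next
  fix u y
  assume u: "u \<in> verts (BGamma_on f n A)" and y: "y \<in> verts (BGamma_on f k A)"
    and adj: "map_sum (take k) (take k) u \<rightarrow>\<^bsub>BGamma_on f k A\<^esub> y"
  \<comment> \<open>Truncation keeps the first coordinate, so a lift stays in the subgraph induced
    by \<open>A\<close>.\<close>
  have vert: "take k a = b \<Longrightarrow> b ! 0 \<in> A \<Longrightarrow> a ! 0 \<in> A" for a b
    using k by auto
  show "\<exists>!v. v \<in> verts (BGamma_on f n A) \<and> map_sum (take k) (take k) v = y \<and>
      u \<rightarrow>\<^bsub>BGamma_on f n A\<^esub> v"
  proof (cases u)
    case (Inl p)
    then obtain l where l: "y = Inr l" "l \<in> tuples k" "l ! 0 \<in> A"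
      "defining_relations f k (take k p) l"
      using adj by (auto simp: arcs_ends_BGamma_on verts_BGamma_on)
    then have "\<exists>!l'. l' \<in> tuples n \<and> take k l' = l \<and> defining_relations f n p l'"
      by (intro defining_relations_unique_lift k)
    then obtain l' where l': "l' \<in> tuples n" "take k l' = l" "defining_relations f n p l'"
      and uniq: "\<And>x. x \<in> tuples n \<Longrightarrow> take k x = l \<Longrightarrow> defining_relations f n p x \<Longrightarrow> x = l'"
      by metis
    show ?thesis
    proof (rule ex1I[of _ "Inr l'"])
      show "Inr l' \<in> verts (BGamma_on f n A) \<and> map_sum (take k) (take k) (Inr l') = y \<and>
          u \<rightarrow>\<^bsub>BGamma_on f n A\<^esub> Inr l'"
        using u Inl l l' vert[OF l'(2)] by (auto simp: arcs_ends_BGamma_on verts_BGamma_on)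
    qed (use l Inl uniq in \<open>auto simp: arcs_ends_BGamma_on verts_BGamma_on\<close>)
  next
    case (Inr l)
    then obtain p where p: "y = Inl p" "p \<in> tuples k" "p ! 0 \<in> A"
      "defining_relations f k p (take k l)"
      using adj by (auto simp: arcs_ends_BGamma_on verts_BGamma_on)
    then have "\<exists>!p'. p' \<in> tuples n \<and> take k p' = p \<and> defining_relations f n p' l"
      by (intro defining_relations_unique_lift_left k)
    then obtain p' where p': "p' \<in> tuples n" "take k p' = p" "defining_relations f n p' l"
      and uniq: "\<And>x. x \<in> tuples n \<Longrightarrow> take k x = p \<Longrightarrow> defining_relations f n x l \<Longrightarrow> x = p'"
      by metis
    show ?thesis
    proof (rule ex1I[of _ "Inl p'"])
      show "Inl p' \<in> verts (BGamma_on f n A) \<and> map_sum (take k) (take k) (Inl p') = y \<and>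
          u \<rightarrow>\<^bsub>BGamma_on f n A\<^esub> Inl p'"
        using u Inr p p' vert[OF p'(2)] by (auto simp: arcs_ends_BGamma_on verts_BGamma_on)
    qed (use p Inr uniq in \<open>auto simp: arcs_ends_BGamma_on verts_BGamma_on\<close>)
  qed
qed

text \<open>Since \<open>Gamma\<close> has no loop arcs, an edge with equal truncations would have
  no image; \<open>no_loop\<close> excludes this.\<close>

lemma graph_spectrum_Gamma_on_subseteq:
  fixes A :: "'r::{finite,comm_ring_1} set"
  assumes k: "1 \<le> k" "k \<le> n"
    and no_loop: "\<And>u v. u \<rightarrow>\<^bsub>Gamma_on f n A\<^esub> v \<Longrightarrow> take k u \<noteq> take k v"
  shows "graph_spectrum (Gamma_on f k A) \<subseteq># graph_spectrum (Gamma_on f n A)"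
proof (rule graph_spectrum_subseteq_covering[where \<phi> = "take k"])
  show "finite (verts (Gamma_on f n A))"
    by (simp add: verts_Gamma_on)
  show "take k ` verts (Gamma_on f n A) = verts (Gamma_on f k A)"
    unfolding verts_Gamma_on by (rule take_image_tuples[OF k])
next
  fix u v assume "u \<rightarrow>\<^bsub>Gamma_on f n A\<^esub> v"
  then show "take k u \<rightarrow>\<^bsub>Gamma_on f k A\<^esub> take k v"
    using k no_loop[of u v] by (auto simp: arcs_ends_Gamma_on verts_Gamma_on tuples_def
        defining_relations_iff_take[OF k, of f])
next
  fix u y
  assume u: "u \<in> verts (Gamma_on f n A)" and y: "y \<in> verts (Gamma_on f k A)"
    and adj: "take k u \<rightarrow>\<^bsub>Gamma_on f k A\<^esub> y"
  have "y \<in> tuples k" "defining_relations f k (take k u) y"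
    using adj by (auto simp: arcs_ends_Gamma_on verts_Gamma_on)
  then have ex1: "\<exists>!v. v \<in> tuples n \<and> take k v = y \<and> defining_relations f n u v"
    by (intro defining_relations_unique_lift k)
  \<comment> \<open>An arc of the smaller graph has distinct ends, so \<open>take k u\<close>
    differs from \<open>y\<close>, and a lift \<open>v\<close> of \<open>y\<close> cannot equal
    \<open>u\<close>.\<close>
  have "v ! 0 \<in> A" "u \<noteq> v" if "take k v = y" for v
    using that y adj k by (auto simp: verts_Gamma_on arcs_ends_Gamma_on)
  then have "v \<in> verts (Gamma_on f n A) \<and> take k v = y \<and> u \<rightarrow>\<^bsub>Gamma_on f n A\<^esub> v \<longleftrightarrow>
      v \<in> tuples n \<and> take k v = y \<and> defining_relations f n u v" for v
    using u by (auto simp: verts_Gamma_on arcs_ends_Gamma_on)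
  then show "\<exists>!v. v \<in> verts (Gamma_on f n A) \<and> take k v = y \<and> u \<rightarrow>\<^bsub>Gamma_on f n A\<^esub> v"
    using ex1 by simp
qed

theorem theorem3p4:
  fixes A :: "'r::{finite,comm_ring_1} set" and k n :: nat
  assumes "2 \<le> k" and "k < n"
  shows "(\<forall>f :: nat \<Rightarrow> 'r list \<Rightarrow> 'r.
            graph_spectrum (BGamma_on f k A) \<subseteq># graph_spectrum (BGamma_on f n A))
       \<and> (\<forall>f :: nat \<Rightarrow> 'r list \<Rightarrow> 'r.
            (\<forall>i\<in>{2..n}. symmetric_function i (f i)) \<longrightarrow>
            \<not> (\<exists>u v. u \<rightarrow>\<^bsub>Gamma_on f n A\<^esub> v \<and> take k u = take k v) \<longrightarrow>
            graph_spectrum (Gamma_on f k A) \<subseteq># graph_spectrum (Gamma_on f n A))"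
proof -
  have k: "1 \<le> k" "k \<le> n"
    using assms by auto
  show ?thesis
    using graph_spectrum_BGamma_on_subseteq[OF k] graph_spectrum_Gamma_on_subseteq[OF k] by blast
qed

end
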